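(* For any number $c$, there exists a finite set of points on a line such that, for every orientation of the edges of its minimum spanning tree $T$ as links, $T$ cannot be partitioned into at most $c$ sets $S_1,\dots,S_c$ such that for each $i$ and each $\ell'\in S_i$, $\sum_{\ell\in S_i,\ \ell\le\ell'}f_\ell(\ell')\le\gamma$.
   Context: A link $\ell=(s,r)$ is an ordered pair of points; its length, also denoted $\ell$, is $d(s,r)$; $\ell\le\ell'$ compares lengths. For links $\ell=(s,r),\ell'=(s',r')$, $d_{\ell\ell'}=d(s,r')$ and $d(\ell,\ell')=\min\{d_{\ell\ell'},d_{\ell'\ell}\}$. Constants $\alpha>2$, $\beta\ge1$, and $\gamma=\frac{1}{4\cdot3^\alpha(4\beta+2)}$. Define $f_\ell(\ell')=\min\{1,\ell^\alpha/d(\ell,\ell')^\alpha\}$ if $\ell\le\ell'$ and $\ell\ne\ell'$; $f_\ell(\ell)=0$; $f_\ell(\ell')=0$ if $\ell>\ell'$. For points on a line, the minimum spanning tree connects each point to its immediate neighbors. *)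

theory Defs
  imports "HOL-Analysis.Analysis" "HOL-Library.Disjoint_Sets"
begin

section \<open>Euclidean minimum spanning trees\<close>

text \<open>Undirected graphs are sets of two-element vertex sets.\<close>

definition complete_edges :: "'a set \<Rightarrow> 'a set set" where
  "complete_edges P = {{u, v} | u v. u \<in> P \<and> v \<in> P \<and> u \<noteq> v}"

definition edges_connect :: "'a set \<Rightarrow> 'a set set \<Rightarrow> bool" where
  "edges_connect P E \<longleftrightarrow> (\<forall>u\<in>P. \<forall>v\<in>P. (u, v) \<in> {(x, y). {x, y} \<in> E}\<^sup>*)"

definition has_cycle :: "'a set set \<Rightarrow> bool" where
  "has_cycle E \<longleftrightarrow> (\<exists>xs. 3 \<le> length xs \<and> distinct xs \<and>
     (\<forall>i<length xs. {xs ! i, xs ! (Suc i mod length xs)} \<in> E))"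

definition spanning_tree :: "'a set \<Rightarrow> 'a set set \<Rightarrow> bool" where
  "spanning_tree P T \<longleftrightarrow> T \<subseteq> complete_edges P \<and> edges_connect P T \<and> \<not> has_cycle T"

text \<open>The length of an edge is its diameter, as \<open>diameter {u, v} = dist u v\<close>.\<close>

definition tree_weight :: "'a::metric_space set set \<Rightarrow> real" where
  "tree_weight T = (\<Sum>e\<in>T. diameter e)"

definition minimum_spanning_tree :: "'a::metric_space set \<Rightarrow> 'a set set \<Rightarrow> bool" where
  "minimum_spanning_tree P T \<longleftrightarrow> spanning_tree P T \<and>
     (\<forall>T'. spanning_tree P T' \<longrightarrow> tree_weight T \<le> tree_weight T')"


section \<open>Links\<close>

type_synonym 'a link = "'a \<times> 'a"  \<comment> \<open>(sender, receiver)\<close>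

definition orientation_of :: "'a set set \<Rightarrow> 'a link set \<Rightarrow> bool" where
  "orientation_of T L \<longleftrightarrow> bij_betw (\<lambda>(s, r). {s, r}) L T"

definition link_length :: "'a::metric_space link \<Rightarrow> real" where
  "link_length l = dist (fst l) (snd l)"

definition link_dist :: "'a::metric_space link \<Rightarrow> 'a link \<Rightarrow> real" where
  "link_dist l l' = min (dist (fst l) (snd l')) (dist (fst l') (snd l))"

text \<open>Two distinct links may be at distance 0 (the receiver of one is the sender of the other).
  The quotient is then infinite and the minimum is 1, which the division by zero of HOL
  would not give.\<close>

definition interference :: "real \<Rightarrow> 'a::metric_space link \<Rightarrow> 'a link \<Rightarrow> real" where
  "interference \<alpha> l l' =
     (if l = l' \<or> link_length l > link_length l' then 0
      else if link_dist l l' = 0 then 1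
      else min 1 (link_length l powr \<alpha> / link_dist l l' powr \<alpha>))"

definition gamma_const :: "real \<Rightarrow> real \<Rightarrow> real" where
  "gamma_const \<alpha> \<beta> = 1 / (4 * 3 powr \<alpha> * (4 * \<beta> + 2))"


section \<open>The minimum spanning tree of points on a line\<close>

definition neighbour_edges :: "real set \<Rightarrow> real set set" where
  "neighbour_edges P = {{u, v} | u v. u \<in> P \<and> v \<in> P \<and> u < v \<and> {u<..<v} \<inter> P = {}}"

definition gaps :: "real set \<Rightarrow> (real \<times> real) set" where
  "gaps P = {(u, v). u \<in> P \<and> v \<in> P \<and> u < v \<and> {u<..<v} \<inter> P = {}}"

lemma diameter_pair: "diameter {u, v :: 'a::metric_space} = dist u v"
proof -
  have "(\<lambda>(x, y). dist x y) ` ({u, v} \<times> {u, v}) = {0, dist u v}"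
    by (auto simp: dist_commute image_iff)
  then show ?thesis
    by (auto simp: diameter_def intro!: cSup_eq_maximum)
qed

lemma neighbour_edges_gaps: "neighbour_edges P = (\<lambda>(u, v). {u, v}) ` gaps P"
  by (fastforce simp: neighbour_edges_def gaps_def)

lemma gapsD: "(u, v) \<in> gaps P \<Longrightarrow> x \<in> P \<Longrightarrow> x \<le> u \<or> v \<le> x"
  by (auto simp: gaps_def disjoint_iff not_le[symmetric])

lemma neighbour_edges_gapsD:
  assumes "{x, y} \<in> neighbour_edges P" "x \<le> y"
  shows "(x, y) \<in> gaps P"
proof -
  obtain u v where uv: "{x, y} = {u, v}" "(u, v) \<in> gaps P"
    using assms(1) unfolding neighbour_edges_def gaps_def by blast
  moreover have "u < v" using uv by (simp add: gaps_def)
  ultimately show ?thesis using assms(2) by (auto simp: doubleton_eq_iff)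
qed

lemma finite_gaps: "finite P \<Longrightarrow> finite (gaps P)"
  by (rule finite_subset[of _ "P \<times> P"]) (auto simp: gaps_def)

lemma finite_complete_edges: "finite P \<Longrightarrow> finite (complete_edges P)"
  by (rule finite_subset[of _ "Pow P"]) (auto simp: complete_edges_def)

lemma complete_edgesE:
  fixes P :: "'a::linorder set"
  assumes "e \<in> complete_edges P"
  obtains u v where "e = {u, v}" "u \<in> P" "v \<in> P" "u < v"
proof -
  obtain u v where *: "e = {u, v}" "u \<in> P" "v \<in> P" "u \<noteq> v"
    using assms by (auto simp: complete_edges_def)
  show thesis
  proof (cases "u < v")
    case True
    with * that show ?thesis by blast
  next
    case False
    with * have "v < u" by auto
    with * that[of v u] show ?thesis by (simp add: insert_commute)
  qed
qed

lemma gap_after: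
  fixes P :: "real set"
  assumes "finite P" "u \<in> P" "v \<in> P" "u < v"
  obtains w where "(u, w) \<in> gaps P" "w \<le> v"
proof -
  let ?A = "{x \<in> P. u < x}"
  have A: "finite ?A" "?A \<noteq> {}" using assms by auto
  have "Min ?A \<in> ?A" using A by (rule Min_in)
  moreover have le: "Min ?A \<le> x" if "x \<in> P" "u < x" for x using A that by simp
  have "{u<..<Min ?A} \<inter> P = {}" unfolding disjoint_iff greaterThanLessThan_iff
    using le leD by blast
  moreover have "Min ?A \<le> v" using le assms by simp
  ultimately have "(u, Min ?A) \<in> gaps P" "Min ?A \<le> v"
    using assms by (simp_all add: gaps_def del: Min_gr_iff Min_less_iff)
  then show thesis by (rule that)
qed

lemma gap_induct [consumes 4, case_names refl step]:
  fixes P :: "real set"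
  assumes "finite P" "u \<in> P" "v \<in> P" "u \<le> v"
  assumes refl: "Q v"
  assumes step: "\<And>u w. (u, w) \<in> gaps P \<Longrightarrow> w \<le> v \<Longrightarrow> Q w \<Longrightarrow> Q u"
  shows "Q u"
  using assms(2,4)
proof (induction "card {x \<in> P. u < x}" arbitrary: u rule: less_induct)
  case less
  show ?case
  proof (cases "u = v")
    case True
    then show ?thesis using refl by simp
  next
    case False
    then obtain w where w: "(u, w) \<in> gaps P" "w \<le> v"
      using gap_after[of P u v] assms(1,3) less by auto
    have "{x \<in> P. w < x} \<subset> {x \<in> P. u < x}" using w by (auto simp: gaps_def)
    then have "card {x \<in> P. w < x} < card {x \<in> P. u < x}"
      using assms(1) by (intro psubset_card_mono) auto
    then have "Q w" using less(1)[of w] w by (auto simp: gaps_def)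
    then show ?thesis using step w by blast
  qed
qed

lemma length_eq_sum_gaps:
  fixes P :: "real set"
  assumes "finite P" "u \<in> P" "v \<in> P" "u \<le> v"
  shows "v - u = (\<Sum>(a, b)\<in>{(a, b) \<in> gaps P. u \<le> a \<and> b \<le> v}. b - a)"
  using assms
proof (induction rule: gap_induct)
  case refl
  have *: "{(a, b) \<in> gaps P. v \<le> a \<and> b \<le> v} = {}" by (auto simp: gaps_def)
  show ?case unfolding * by simp
next
  case (step u w)
  have "{(a, b) \<in> gaps P. u \<le> a \<and> b \<le> v} =
      insert (u, w) {(a, b) \<in> gaps P. w \<le> a \<and> b \<le> v}"
  proof (intro set_eqI iffI)
    fix g assume g: "g \<in> {(a, b) \<in> gaps P. u \<le> a \<and> b \<le> v}"
    obtain a b where ab: "g = (a, b)" by (cases g)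
    show "g \<in> insert (u, w) {(a, b) \<in> gaps P. w \<le> a \<and> b \<le> v}"
    proof (cases "a = u")
      case True
      have "b \<notin> {u<..<w}" "w \<notin> {a<..<b}" using g ab step(1) by (auto simp: gaps_def disjoint_iff)
      then show ?thesis using g ab step(1) True by (auto simp: gaps_def)
    next
      case False
      have "a \<notin> {u<..<w}" using g ab step(1) by (auto simp: gaps_def disjoint_iff)
      then show ?thesis using g ab False by auto
    qed
  qed (use step(1,2) in \<open>auto simp: gaps_def\<close>)
  moreover have "(u, w) \<notin> {(a, b) \<in> gaps P. w \<le> a \<and> b \<le> v}"
    using step(1) by (auto simp: gaps_def)
  moreover have "finite {(a, b) \<in> gaps P. w \<le> a \<and> b \<le> v}"
    using finite_gaps[OF assms(1)] by (auto intro: finite_subset)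
  ultimately show ?case using step(3) by simp
qed

lemma rtrancl_leaves:
  assumes "(x, y) \<in> R\<^sup>*" "x \<in> A" "y \<notin> A"
  obtains a b where "(a, b) \<in> R" "a \<in> A" "b \<notin> A"
proof -
  have "x \<in> A \<Longrightarrow> y \<in> A \<or> (\<exists>a b. (a, b) \<in> R \<and> a \<in> A \<and> b \<notin> A)"
    using assms(1) by (induction rule: rtrancl_induct) blast+
  then show thesis using assms that by blast
qed

definition crossing :: "real set set \<Rightarrow> real \<times> real \<Rightarrow> real set set" where
  "crossing T = (\<lambda>(a, b). {e \<in> T. (\<exists>u\<in>e. u \<le> a) \<and> (\<exists>v\<in>e. b \<le> v)})"

lemma tree_weight_crossing:
  assumes "finite P" "T \<subseteq> complete_edges P"
  shows "tree_weight T = (\<Sum>(a, b)\<in>gaps P. real (card (crossing T (a, b))) * (b - a))"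
proof -
  have fT: "finite T" using assms finite_complete_edges finite_subset by blast
  have fG: "finite (gaps P)" using assms finite_gaps by blast
  have "tree_weight T =
      (\<Sum>e\<in>T. \<Sum>(a, b)\<in>{(a, b) \<in> gaps P. (\<exists>u\<in>e. u \<le> a) \<and> (\<exists>v\<in>e. b \<le> v)}. b - a)"
    unfolding tree_weight_def
  proof (rule sum.cong)
    fix e assume "e \<in> T"
    then obtain u v where e: "e = {u, v}" "u \<in> P" "v \<in> P" "u < v"
      using assms complete_edgesE by blast
    have *: "{(a, b) \<in> gaps P. (\<exists>x\<in>e. x \<le> a) \<and> (\<exists>y\<in>e. b \<le> y)} =
        {(a, b) \<in> gaps P. u \<le> a \<and> b \<le> v}"
      using e by (auto simp: gaps_def)
    show "diameter e = (\<Sum>(a, b)\<in>{(a, b) \<in> gaps P. (\<exists>u\<in>e. u \<le> a) \<and> (\<exists>v\<in>e. b \<le> v)}. b - a)"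
      unfolding * using length_eq_sum_gaps[OF assms(1), of u v] e
      by (simp add: diameter_pair dist_real_def)
  qed simp
  also have "\<dots> = (\<Sum>e\<in>T. \<Sum>g\<in>gaps P. if e \<in> crossing T g then snd g - fst g else 0)"
  proof (rule sum.cong)
    fix e assume "e \<in> T"
    have *: "{(a, b) \<in> gaps P. (\<exists>u\<in>e. u \<le> a) \<and> (\<exists>v\<in>e. b \<le> v)} = {g \<in> gaps P. e \<in> crossing T g}"
      using \<open>e \<in> T\<close> by (auto simp: crossing_def)
    show "(\<Sum>(a, b)\<in>{(a, b) \<in> gaps P. (\<exists>u\<in>e. u \<le> a) \<and> (\<exists>v\<in>e. b \<le> v)}. b - a) =
      (\<Sum>g\<in>gaps P. if e \<in> crossing T g then snd g - fst g else 0)"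
      unfolding * using fG by (simp add: sum.inter_filter case_prod_beta)
  qed simp
  also have "\<dots> = (\<Sum>g\<in>gaps P. \<Sum>e\<in>T. if e \<in> crossing T g then snd g - fst g else 0)"
    by (rule sum.swap)
  also have "\<dots> = (\<Sum>(a, b)\<in>gaps P. real (card (crossing T (a, b))) * (b - a))"
  proof (rule sum.cong)
    fix g assume "g \<in> gaps P"
    have "{e \<in> T. e \<in> crossing T g} = crossing T g" by (auto simp: crossing_def)
    then show "(\<Sum>e\<in>T. if e \<in> crossing T g then snd g - fst g else 0) =
        (case g of (a, b) \<Rightarrow> real (card (crossing T (a, b))) * (b - a))"
      using fT by (simp add: sum.inter_filter[symmetric] case_prod_beta)
  qed simp
  finally show ?thesis .
qed

lemma crossing_nonempty:
  assumes "T \<subseteq> complete_edges P" "edges_connect P T" "(a, b) \<in> gaps P"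
  shows "crossing T (a, b) \<noteq> {}"
proof -
  have ab: "a \<in> P" "b \<in> P" "a < b" "{a<..<b} \<inter> P = {}" using assms by (auto simp: gaps_def)
  then have "(a, b) \<in> {(x, y). {x, y} \<in> T}\<^sup>*" using assms by (auto simp: edges_connect_def)
  then obtain x y where xy: "{x, y} \<in> T" "x \<le> a" "\<not> y \<le> a"
    using ab by (elim rtrancl_leaves[where A = "{..a}"]) auto
  have "y \<in> P" using xy assms(1) by (auto simp: complete_edges_def doubleton_eq_iff)
  then have "b \<le> y" using ab xy by (meson disjoint_iff greaterThanLessThan_iff not_le)
  then show ?thesis using xy by (auto simp: crossing_def)
qed

lemma crossing_neighbour_edges:
  assumes "(a, b) \<in> gaps P"
  shows "crossing (neighbour_edges P) (a, b) = {{a, b}}"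
proof -
  have "e = {a, b}" if e: "e \<in> crossing (neighbour_edges P) (a, b)" for e
  proof -
    obtain u v where uv: "e = {u, v}" "(u, v) \<in> gaps P"
      using e by (auto simp: crossing_def neighbour_edges_gaps)
    then have "u \<le> a" "b \<le> v" using e assms by (auto simp: crossing_def gaps_def)
    moreover have "a \<notin> {u<..<v}" "b \<notin> {u<..<v}" using uv assms by (auto simp: gaps_def disjoint_iff)
    ultimately show ?thesis using assms uv by (auto simp: gaps_def)
  qed
  moreover have "{a, b} \<in> crossing (neighbour_edges P) (a, b)"
    using assms by (auto simp: crossing_def neighbour_edges_gaps)
  ultimately show ?thesis by blast
qed

lemma neighbour_edges_subset: "neighbour_edges P \<subseteq> complete_edges P"
  unfolding neighbour_edges_def complete_edges_def by blast

lemma tree_weight_neighbour_edges: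
  assumes "finite P"
  shows "tree_weight (neighbour_edges P) = (\<Sum>(a, b)\<in>gaps P. b - a)"
  unfolding tree_weight_crossing[OF assms neighbour_edges_subset]
  by (rule sum.cong) (auto simp: crossing_neighbour_edges)

lemma neighbour_edges_connect:
  assumes "finite P"
  shows "edges_connect P (neighbour_edges P)"
proof -
  let ?R = "{(x, y). {x, y} \<in> neighbour_edges P}"
  have sym: "sym (?R\<^sup>*)" by (intro sym_rtrancl) (auto simp: sym_def insert_commute)
  have *: "(u, v) \<in> ?R\<^sup>*" if "u \<in> P" "v \<in> P" "u \<le> v" for u v
    using assms that
  proof (induction rule: gap_induct)
    case (step u w)
    then have "(u, w) \<in> ?R" by (auto simp: neighbour_edges_gaps)
    then show ?case using step(3) by (rule converse_rtrancl_into_rtrancl)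
  qed simp
  have "(u, v) \<in> ?R\<^sup>*" if "u \<in> P" "v \<in> P" for u v
    using *[of u v] *[of v u] that symD[OF sym] by (cases "u \<le> v") auto
  then show ?thesis by (auto simp: edges_connect_def)
qed

lemma neighbour_edges_acyclic: "\<not> has_cycle (neighbour_edges P)"
proof
  assume "has_cycle (neighbour_edges P)"
  then obtain xs where xs: "3 \<le> length xs" "distinct xs"
    and edge: "\<And>i. i < length xs \<Longrightarrow> {xs ! i, xs ! (Suc i mod length xs)} \<in> neighbour_edges P"
    by (auto simp: has_cycle_def)
  let ?n = "length xs"
  have "Max (set xs) \<in> set xs" using xs by (intro Max_in) auto
  then obtain i where i: "i < ?n" "xs ! i = Max (set xs)" by (auto simp: in_set_conv_nth)
  define j where "j = (i + (?n - 1)) mod ?n"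
  define k where "k = Suc i mod ?n"
  have "0 < ?n" using xs by linarith
  then have jk: "j < ?n" "k < ?n" by (simp_all add: j_def k_def)
  have j: "j = (if i = 0 then ?n - 1 else i - 1)"
  proof (cases "i = 0")
    case False
    then have "i + (?n - 1) = (i - 1) + ?n" using i by simp
    then have "j = (i - 1) mod ?n" unfolding j_def by (simp only: mod_add_self2)
    then show ?thesis using False i by simp
  qed (use i in \<open>simp add: j_def\<close>)
  have k: "k = (if Suc i = ?n then 0 else Suc i)" using i by (simp add: k_def)
  have "Suc j mod ?n = i" using j i by auto
  then have ej: "{xs ! j, xs ! i} \<in> neighbour_edges P" using edge[OF jk(1)] by simp
  have ek: "{xs ! k, xs ! i} \<in> neighbour_edges P"
    using edge[OF i(1)] by (simp add: k_def insert_commute)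
  have "j \<noteq> k" using j k xs i by (auto split: if_splits)
  then have ne: "xs ! j \<noteq> xs ! k" using xs jk by (simp add: nth_eq_iff_index_eq)
  have le: "xs ! j \<le> xs ! i" "xs ! k \<le> xs ! i" using i jk by auto
  have gj: "(xs ! j, xs ! i) \<in> gaps P" and gk: "(xs ! k, xs ! i) \<in> gaps P"
    using ej ek le by (simp_all add: neighbour_edges_gapsD)
  have "xs ! j \<in> P" "xs ! j < xs ! i" "xs ! k \<in> P" "xs ! k < xs ! i"
    using gj gk by (auto simp: gaps_def)
  then show False using ne gapsD[OF gj, of "xs ! k"] gapsD[OF gk, of "xs ! j"] by auto
qed

lemma spanning_tree_neighbour_edges: "finite P \<Longrightarrow> spanning_tree P (neighbour_edges P)"
  by (simp add: spanning_tree_def neighbour_edges_subset neighbour_edges_connect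
      neighbour_edges_acyclic)

lemma crossing_card_ge_1:
  assumes "finite P" "T \<subseteq> complete_edges P" "edges_connect P T" "(a, b) \<in> gaps P"
  shows "1 \<le> card (crossing T (a, b))"
proof -
  have "finite (crossing T (a, b))"
    using assms finite_complete_edges[OF assms(1)]
    by (auto simp: crossing_def intro: finite_subset)
  then show ?thesis using crossing_nonempty[OF assms(2-4)] by (simp add: Suc_leI card_gt_0_iff)
qed

lemma tree_weight_ge:
  assumes "finite P" "T \<subseteq> complete_edges P" "edges_connect P T"
  shows "tree_weight (neighbour_edges P) \<le> tree_weight T"
  unfolding tree_weight_crossing[OF assms(1,2)] tree_weight_neighbour_edges[OF assms(1)]
proof (rule sum_mono, clarify)
  fix a b assume g: "(a, b) \<in> gaps P"
  have "a \<le> b" using g by (auto simp: gaps_def)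
  moreover have "1 \<le> real (card (crossing T (a, b)))"
    using crossing_card_ge_1[OF assms g] by simp
  ultimately show "b - a \<le> real (card (crossing T (a, b))) * (b - a)"
    using mult_right_mono[of 1 "real (card (crossing T (a, b)))" "b - a"] by simp
qed

lemma tree_weight_eq:
  assumes "finite P" "T \<subseteq> complete_edges P" "edges_connect P T"
    and "tree_weight T \<le> tree_weight (neighbour_edges P)"
  shows "T = neighbour_edges P"
proof -
  have one: "card (crossing T (a, b)) = 1" if g: "(a, b) \<in> gaps P" for a b
  proof (rule ccontr)
    assume "card (crossing T (a, b)) \<noteq> 1"
    then have "1 < real (card (crossing T (a, b)))"
      using crossing_card_ge_1[OF assms(1-3) g] by simp
    then have "b - a < real (card (crossing T (a, b))) * (b - a)"
      using mult_strict_right_mono[of 1 "real (card (crossing T (a, b)))" "b - a"] g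
      by (simp add: gaps_def)
    moreover have "b - a \<le> real (card (crossing T (a, b))) * (b - a)" if "(a, b) \<in> gaps P" for a b
    proof -
      have "a \<le> b" using that by (auto simp: gaps_def)
      moreover have "1 \<le> real (card (crossing T (a, b)))"
        using crossing_card_ge_1[OF assms(1-3) that] by simp
      ultimately show ?thesis
        using mult_right_mono[of 1 "real (card (crossing T (a, b)))" "b - a"] by simp
    qed
    ultimately have "(\<Sum>(a, b)\<in>gaps P. b - a) <
        (\<Sum>(a, b)\<in>gaps P. real (card (crossing T (a, b))) * (b - a))"
      using g finite_gaps[OF assms(1)]
      by (intro sum_strict_mono_ex1) force+
    then show False
      using assms(4) tree_weight_crossing[OF assms(1,2)] tree_weight_neighbour_edges[OF assms(1)]
      by simp
  qed
  have sub: "T \<subseteq> neighbour_edges P"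
  proof
    fix e assume eT: "e \<in> T"
    then obtain u v where e: "e = {u, v}" "u \<in> P" "v \<in> P" "u < v"
      using assms complete_edgesE by blast
    have "{u<..<v} \<inter> P = {}"
    proof (rule ccontr)
      assume "{u<..<v} \<inter> P \<noteq> {}"
      then obtain p where p: "p \<in> P" "u < p" "p < v" by auto
      then have "(p, u) \<in> {(x, y). {x, y} \<in> T}\<^sup>*"
        using assms(3) e by (auto simp: edges_connect_def)
      then obtain x y where xy: "{x, y} \<in> T" "u < x" "x < v" "\<not> (u < y \<and> y < v)"
        using p by (elim rtrancl_leaves[where A = "{u<..<v}"]) auto
      have P: "x \<in> P" "y \<in> P"
        using xy(1) assms(2) by (auto simp: complete_edges_def doubleton_eq_iff)
      have "\<exists>g\<in>gaps P. e \<in> crossing T g \<and> {x, y} \<in> crossing T g"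
      proof (cases "y \<le> u")
        case True
        obtain w where "(u, w) \<in> gaps P" "w \<le> x"
          using gap_after[OF assms(1), of u x] e P xy by auto
        then show ?thesis using True xy e eT
          by (intro bexI[of _ "(u, w)"]) (auto simp: crossing_def intro: less_imp_le)
      next
        case False
        then have "v \<le> y" using xy by auto
        obtain w where "(x, w) \<in> gaps P" "w \<le> v"
          using gap_after[OF assms(1), of x v] e P xy by auto
        then show ?thesis using \<open>v \<le> y\<close> xy e eT
          by (intro bexI[of _ "(x, w)"]) (auto simp: crossing_def intro: less_imp_le)
      qed
      then have "e = {x, y}" using one by (metis card_1_singletonE singletonD surj_pair)
      then show False using e xy by (auto simp: doubleton_eq_iff)
    qed
    then show "e \<in> neighbour_edges P" using e by (auto simp: neighbour_edges_def)
  qed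
  moreover have "neighbour_edges P \<subseteq> T"
  proof
    fix e assume "e \<in> neighbour_edges P"
    then obtain a b where ab: "e = {a, b}" "(a, b) \<in> gaps P" by (auto simp: neighbour_edges_gaps)
    have "crossing T (a, b) \<subseteq> crossing (neighbour_edges P) (a, b)"
      using sub by (auto simp: crossing_def)
    then have "crossing T (a, b) = {{a, b}}"
      using crossing_neighbour_edges[OF ab(2)] crossing_nonempty[OF assms(2,3) ab(2)] by auto
    then show "e \<in> T" using ab by (auto simp: crossing_def)
  qed
  ultimately show ?thesis by blast
qed

theorem minimum_spanning_tree_line:
  assumes "finite P"
  shows "minimum_spanning_tree P T \<longleftrightarrow> T = neighbour_edges P"
proof
  assume T: "minimum_spanning_tree P T"
  then have "tree_weight T \<le> tree_weight (neighbour_edges P)"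
    using spanning_tree_neighbour_edges[OF assms] by (simp add: minimum_spanning_tree_def)
  then show "T = neighbour_edges P"
    using T assms by (intro tree_weight_eq)
      (simp_all add: minimum_spanning_tree_def spanning_tree_def)
next
  assume "T = neighbour_edges P"
  then show "minimum_spanning_tree P T"
    using spanning_tree_neighbour_edges[OF assms] tree_weight_ge[OF assms]
    by (simp add: minimum_spanning_tree_def spanning_tree_def)
qed

end

theory Submission
  imports Defs
begin

text \<open>By induction on \<open>t\<close>, every interval contains a configuration of gaps that needs \<open>t\<close> colours and
  whose gaps are not shorter than a fixed fraction of the interval. For the step, put copies of the
  configuration for \<open>t\<close> at geometrically increasing scales to the right of one long gap. A colour
  that occurs in all copies contributes at least a constant to the interference on the long gap from
  each of them, hence too much in total if there are enough copies. So the colour of the long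
  gap is missing in some copy, which already uses \<open>t\<close> other colours.\<close>

definition feasible :: "real \<Rightarrow> real \<Rightarrow> 'a::metric_space link set \<Rightarrow> bool" where
  "feasible \<alpha> g S \<longleftrightarrow>
     (\<forall>l'\<in>S. (\<Sum>l\<in>{l \<in> S. link_length l \<le> link_length l'}. interference \<alpha> l l') \<le> g)"

text \<open>Gaps are stored left to right, whereas the orientation of the links is chosen after the
  points; hence either direction counts.\<close>

definition occurs :: "'a link \<Rightarrow> 'a link set \<Rightarrow> bool" where
  "occurs x S \<longleftrightarrow> x \<in> S \<or> prod.swap x \<in> S"

text \<open>The sets in \<open>\<S>\<close> may contain further links, so that the property is inherited by
  larger configurations.\<close>

definition needs_colours :: "real \<Rightarrow> real \<Rightarrow> nat \<Rightarrow> 'a::metric_space link set \<Rightarrow> bool" where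
  "needs_colours \<alpha> g t G \<longleftrightarrow>
     (\<forall>\<S>. finite \<S> \<longrightarrow> (\<forall>S\<in>\<S>. finite S \<and> feasible \<alpha> g S) \<longrightarrow> (\<forall>x\<in>G. \<exists>S\<in>\<S>. occurs x S) \<longrightarrow>
        t \<le> card {S \<in> \<S>. \<exists>x\<in>G. occurs x S})"

lemma interference_nonneg: "0 \<le> interference \<alpha> l l'"
  by (simp add: interference_def)

text \<open>For nonzero distance at most \<open>D\<close>, the last hypothesis makes the quotient at
  least \<open>q\<close>; distance 0 gives 1. As \<open>link_dist\<close> is a minimum, a bound on
  one of the two cross distances suffices for \<open>D\<close>.\<close>

lemma interference_ge:
  assumes "0 \<le> \<alpha>" "l \<noteq> l'" "link_length l \<le> link_length l'"
    and "link_dist l l' \<le> D" "0 < D" "0 \<le> q" "q * D \<le> link_length l"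
  shows "min 1 (q powr \<alpha>) \<le> interference \<alpha> l l'"
proof (cases "link_dist l l' = 0")
  case True
  then show ?thesis using assms by (simp add: interference_def)
next
  case False
  then have d: "0 < link_dist l l'" by (auto simp: link_dist_def min_def less_le)
  have "q * link_dist l l' \<le> link_length l"
    using mult_left_mono[OF assms(4,6)] assms(7) by linarith
  then have "q \<le> link_length l / link_dist l l'"
    using d by (simp add: pos_le_divide_eq)
  then have "q powr \<alpha> \<le> (link_length l / link_dist l l') powr \<alpha>"
    using assms by (intro powr_mono2) auto
  also have "\<dots> = link_length l powr \<alpha> / link_dist l l' powr \<alpha>"
    using d by (simp add: powr_divide link_length_def)
  finally show ?thesis using False assms by (auto simp: interference_def)
qed

text \<open>Meant for one link \<open>f j\<close> from each copy: interference is nonnegative, so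
  dropping the other links of the class only lowers the sum.\<close>

lemma feasible_sum_le:
  assumes "feasible \<alpha> g S" "finite S" "l' \<in> S" "finite J" "inj_on f J"
    and "\<And>j. j \<in> J \<Longrightarrow> f j \<in> S \<and> link_length (f j) \<le> link_length l'"
  shows "(\<Sum>j\<in>J. interference \<alpha> (f j) l') \<le> g"
proof -
  have "(\<Sum>j\<in>J. interference \<alpha> (f j) l') = (\<Sum>l\<in>f ` J. interference \<alpha> l l')"
    using assms(5) by (simp add: sum.reindex)
  also have "\<dots> \<le> (\<Sum>l\<in>{l \<in> S. link_length l \<le> link_length l'}. interference \<alpha> l l')"
    using assms by (intro sum_mono2) (auto simp: interference_nonneg)
  also have "\<dots> \<le> g" using assms by (simp add: feasible_def)
  finally show ?thesis .
qed

text \<open>An interval is convex, so a point of \<open>P'\<close> inside a gap of \<open>P\<close>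
  would itself belong to \<open>P\<close>. This carries the gaps of one copy over to the whole point
  set.\<close>

lemma gaps_subset:
  assumes "P' \<inter> {a..<b} = P"
  shows "gaps P \<subseteq> gaps P'"
proof clarify
  fix u v assume uv: "(u, v) \<in> gaps P"
  then have "u \<in> {a..<b} \<inter> P'" "v \<in> {a..<b} \<inter> P'" "u < v" using assms by (auto simp: gaps_def)
  moreover have "{u<..<v} \<inter> P' \<subseteq> {u<..<v} \<inter> P" using calculation assms by auto
  ultimately show "(u, v) \<in> gaps P'" using uv by (auto simp: gaps_def)
qed

text \<open>The fraction \<open>m\<close> is fixed before the interval, so that copies at all scales
  share one interference bound. Half-open intervals keep adjacent copies disjoint, and taking only a
  subset \<open>G\<close> of the gaps allows those between copies to be ignored.\<close>

lemma ex_configuration: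
  assumes "0 < \<alpha>"
  shows "\<exists>m>0. \<forall>a b. a < b \<longrightarrow> (\<exists>P G. finite P \<and> P \<subseteq> {a..<b} \<and> G \<subseteq> gaps P \<and>
           (\<forall>x\<in>G. m * (b - a) \<le> link_length x) \<and> needs_colours \<alpha> g t G)"
proof (induction t)
  case 0
  have "\<exists>P G. finite P \<and> P \<subseteq> {a..<b} \<and> G \<subseteq> gaps P \<and>
           (\<forall>x\<in>G. 1 * (b - a) \<le> link_length x) \<and> needs_colours \<alpha> g 0 G" for a b :: real
    by (intro exI[of _ "{}"]) (simp add: needs_colours_def)
  then show ?case by (intro exI[of _ 1]) simp
next
  case (Suc t)
  then obtain m where m: "0 < m" and
    "\<forall>a b. a < b \<longrightarrow> (\<exists>P G. finite P \<and> P \<subseteq> {a..<b} \<and> G \<subseteq> gaps P \<and>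
           (\<forall>x\<in>G. m * (b - a) \<le> link_length x) \<and> needs_colours \<alpha> g t G)"
    by blast
  then obtain Q H where QH: "\<And>a b. a < b \<Longrightarrow> finite (Q a b) \<and> Q a b \<subseteq> {a..<b} \<and> H a b \<subseteq> gaps (Q a b) \<and>
           (\<forall>x\<in>H a b. m * (b - a) \<le> link_length x) \<and> needs_colours \<alpha> g t (H a b)"
    by metis
  \<comment> \<open>Copy \<open>j\<close> will have gaps of length at least
    \<open>m * (2 ^ j * u)\<close> within distance \<open>2 ^ Suc j * u\<close> of the long gap; the
    ratio \<open>m / 2\<close> is independent of \<open>j\<close>.\<close>
  define \<delta> where "\<delta> = min 1 ((m / 2) powr \<alpha>)"
  have "0 < \<delta>" using m by (simp add: \<delta>_def)
  \<comment> \<open>\<open>k\<close> is the number of copies: contributions of \<delta> from each of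
    them exceed \<open>g\<close>.\<close>
  then obtain k :: nat where k: "g < real k * \<delta>"
    using reals_Archimedean3 by blast
  \<comment> \<open>The long gap takes half of the interval; the worst bound among the copies is
    that of copy 0, whose width is \<open>(b - a) / 2 ^ Suc k\<close>.\<close>
  define m' where "m' = min (1 / 2) (m / 2 ^ Suc k)"
  have "0 < m'" using m by (simp add: m'_def)
  moreover have "\<exists>P G. finite P \<and> P \<subseteq> {a..<b} \<and> G \<subseteq> gaps P \<and>
           (\<forall>x\<in>G. m' * (b - a) \<le> link_length x) \<and> needs_colours \<alpha> g (Suc t) G"
    if ab: "a < b" for a b :: real
  proof -
    \<comment> \<open>Layout: the long gap from \<open>a\<close> to \<open>z\<close> has length
      \<open>2 ^ k * u\<close>. Copy \<open>j\<close> lies between \<open>lo j\<close> and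
      \<open>lo (Suc j)\<close>, a block whose width \<open>2 ^ j * u\<close> equals its distance
      from \<open>z\<close>; \<open>lo k\<close> is \<open>b\<close>.\<close>
    define u where "u = (b - a) / 2 ^ Suc k"
    have u: "0 < u" using ab by (simp add: u_def)
    define z where "z = a + 2 ^ k * u"
    have b: "b = z + 2 ^ k * u" "b - a = 2 ^ Suc k * u" by (simp_all add: z_def u_def field_simps)
    have az: "a < z" "z < b" using u by (simp_all add: z_def b)
    define lo where "lo j = z + 2 ^ j * u" for j :: nat
    have lo_mono: "lo i \<le> lo j" if "i \<le> j" for i j
      using that u by (simp add: lo_def power_increasing)
    have lo_less: "lo j < lo (Suc j)" for j using u by (simp add: lo_def)
    have lo_diff: "lo (Suc j) - lo j = 2 ^ j * u" for j by (simp add: lo_def)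
    have z_lo: "z < lo j" for j using u by (simp add: lo_def)
    have lo_b: "lo (Suc j) \<le> b" if "j < k" for j
      using lo_mono[of "Suc j" k] that by (simp add: b lo_def)
    define PP where "PP j = Q (lo j) (lo (Suc j))" for j
    define GG where "GG j = H (lo j) (lo (Suc j))" for j
    have PP: "finite (PP j)" "PP j \<subseteq> {lo j..<lo (Suc j)}" "GG j \<subseteq> gaps (PP j)"
      and GG_ge: "\<And>x. x \<in> GG j \<Longrightarrow> m * (2 ^ j * u) \<le> link_length x"
      and GG_needs: "needs_colours \<alpha> g t (GG j)" for j
      using QH[OF lo_less[of j]] by (auto simp: PP_def GG_def lo_diff)
    have GG_in: "fst x \<in> {lo j..<lo (Suc j)} \<and> snd x \<in> {lo j..<lo (Suc j)}" if "x \<in> GG j" for x j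
    proof -
      have "fst x \<in> PP j" "snd x \<in> PP j" using that PP(3)[of j] by (auto simp: gaps_def)
      then show ?thesis using PP(2)[of j] by blast
    qed
    \<comment> \<open>The blocks are disjoint. This serves twice: to recover \<open>PP j\<close>
      from \<open>P\<close>, and to show that links chosen from different copies are
      distinct.\<close>
    have index_unique: "i = j" if "p \<in> {lo i..<lo (Suc i)}" "p \<in> {lo j..<lo (Suc j)}" for i j p
      using that lo_mono[of "Suc i" j] lo_mono[of "Suc j" i]
      by (cases i j rule: linorder_cases) auto
    define P where "P = {a, z} \<union> (\<Union>j<k. PP j)"
    define G where "G = insert (a, z) (\<Union>j<k. GG j)"
    have ge_lo: "lo 0 \<le> p" "p < b" if "p \<in> PP j" "j < k" for p j
      using that PP(2)[of j] lo_mono[of 0 j] lo_b[of j] by force+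
    have "finite P" using PP by (simp add: P_def)
    moreover have "P \<subseteq> {a..<b}"
      using ge_lo az z_lo[of 0] by (force simp: P_def)
    moreover have "G \<subseteq> gaps P"
    proof -
      have "(a, z) \<in> gaps P"
        using az ge_lo z_lo[of 0] by (force simp: gaps_def P_def)
      moreover have "GG j \<subseteq> gaps P" if "j < k" for j
      proof -
        have "P \<inter> {lo j..<lo (Suc j)} = PP j"
        proof
          show "P \<inter> {lo j..<lo (Suc j)} \<subseteq> PP j"
          proof
            fix p assume p: "p \<in> P \<inter> {lo j..<lo (Suc j)}"
            then obtain i where i: "p \<in> PP i" using az z_lo[of j] by (auto simp: P_def)
            then have "i = j" using p PP(2)[of i] index_unique by blast
            then show "p \<in> PP j" using i by simp
          qed
        qed (use that PP(2)[of j] in \<open>auto simp: P_def\<close>)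
        then show ?thesis using gaps_subset PP(3) by blast
      qed
      ultimately show ?thesis by (auto simp: G_def)
    qed
    moreover have "\<forall>x\<in>G. m' * (b - a) \<le> link_length x"
    proof
      fix x assume "x \<in> G"
      then consider "x = (a, z)" | j where "j < k" "x \<in> GG j" by (auto simp: G_def)
      then show "m' * (b - a) \<le> link_length x"
      proof cases
        case 1
        have "m' * (b - a) \<le> 1 / 2 * (b - a)"
          using ab by (intro mult_right_mono) (auto simp: m'_def)
        also have "\<dots> = z - a" by (simp add: b z_def)
        finally show ?thesis using 1 az by (simp add: link_length_def dist_real_def)
      next
        case 2
        have "m' * (b - a) \<le> m / 2 ^ Suc k * (b - a)"
          using ab by (intro mult_right_mono) (auto simp: m'_def)
        also have "\<dots> = m * (1 * u)" by (simp add: b(2))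
        also have "\<dots> \<le> m * (2 ^ j * u)"
          using m u by (intro mult_left_mono mult_right_mono) auto
        finally show ?thesis using GG_ge[OF 2(2)] by linarith
      qed
    qed
    moreover have "needs_colours \<alpha> g (Suc t) G"
      unfolding needs_colours_def
    proof (intro allI impI)
      fix \<S> assume fin: "finite \<S>" and S: "\<forall>S\<in>\<S>. finite S \<and> feasible \<alpha> g S"
        and cover: "\<forall>x\<in>G. \<exists>S\<in>\<S>. occurs x S"
      let ?T = "{S \<in> \<S>. \<exists>x\<in>G. occurs x S}"
      let ?T' = "\<lambda>j. {S \<in> \<S>. \<exists>x\<in>GG j. occurs x S}"
      have T': "t \<le> card (?T' j)" "?T' j \<subseteq> ?T" if "j < k" for j
      proof -
        have GG_G: "GG j \<subseteq> G" using that by (auto simp: G_def)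
        then have "\<forall>x\<in>GG j. \<exists>S\<in>\<S>. occurs x S" using cover by blast
        then show "t \<le> card (?T' j)"
          using GG_needs[of j, unfolded needs_colours_def, rule_format, of \<S>] fin S by blast
        show "?T' j \<subseteq> ?T" using GG_G by blast
      qed
      obtain S0 where S0: "S0 \<in> \<S>" "occurs (a, z) S0" using cover by (auto simp: G_def)
      obtain l' where l': "l' \<in> S0" "l' = (a, z) \<or> l' = (z, a)"
        using S0 by (auto simp: occurs_def)
      \<comment> \<open>If the class of the long gap met every copy, one link \<open>f j\<close>
        from each would already violate feasibility at \<open>l'\<close>.\<close>
      have "\<exists>j<k. S0 \<notin> ?T' j"
      proof (rule ccontr)
        assume "\<not> ?thesis"
        then have "\<forall>j\<in>{..<k}. \<exists>l\<in>S0. l \<in> GG j \<or> prod.swap l \<in> GG j"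
          by (fastforce simp: occurs_def)
        then obtain f where f: "\<And>j. j < k \<Longrightarrow> f j \<in> S0 \<and> (f j \<in> GG j \<or> prod.swap (f j) \<in> GG j)"
          by (metis lessThan_iff)
        have f_in: "fst (f j) \<in> {lo j..<lo (Suc j)}" "snd (f j) \<in> {lo j..<lo (Suc j)}" if "j < k" for j
          using f[OF that] GG_in[of "f j" j] GG_in[of "prod.swap (f j)" j] by auto
        \<comment> \<open>Only links no longer than \<open>l'\<close> enter the sum; no block is
          wider than the long gap.\<close>
        have len: "link_length (f j) \<le> link_length l'" if "j < k" for j
        proof -
          have "link_length (f j) \<le> lo (Suc j) - lo j"
            using f_in[OF that] by (auto simp: link_length_def dist_real_def)
          also have "\<dots> \<le> 2 ^ k * u" using u that by (simp add: lo_diff power_increasing)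
          also have "\<dots> = link_length l'"
            using l' u by (auto simp: link_length_def dist_real_def z_def)
          finally show ?thesis .
        qed
        have "\<delta> \<le> interference \<alpha> (f j) l'" if "j < k" for j
          unfolding \<delta>_def
        proof (rule interference_ge)
          show "f j \<noteq> l'" using l' f_in[OF that] z_lo[of j] by auto
          \<comment> \<open>Whichever way both links point, one of the two cross distances joins
            \<open>z\<close> to an endpoint of \<open>f j\<close>, and the block of copy
            \<open>j\<close> ends at distance \<open>2 ^ Suc j * u\<close> from
            \<open>z\<close>.\<close>
          show "link_dist (f j) l' \<le> 2 ^ Suc j * u"
            using l' f_in[OF that] z_lo[of j]
            by (auto simp: link_dist_def dist_real_def min_le_iff_disj lo_def)
          have "link_length (prod.swap (f j)) = link_length (f j)"
            by (simp add: link_length_def dist_commute)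
          then show "m / 2 * (2 ^ Suc j * u) \<le> link_length (f j)"
            using f[OF that] GG_ge[of "f j" j] GG_ge[of "prod.swap (f j)" j] by auto
        qed (use assms m u len[OF that] in auto)
        then have "(\<Sum>j<k. \<delta>) \<le> (\<Sum>j<k. interference \<alpha> (f j) l')"
          by (intro sum_mono) simp
        also have "\<dots> \<le> g"
        proof (rule feasible_sum_le)
          show "inj_on f {..<k}"
            using f_in index_unique by (intro inj_onI) (metis lessThan_iff)
        qed (use S0 S l' f len in auto)
        finally show False using k by simp
      qed
      then obtain j where j: "j < k" "S0 \<notin> ?T' j" by blast
      \<comment> \<open>The class of the long gap is counted for \<open>G\<close> but not for copy
        \<open>j\<close>, which gives the additional colour.\<close>
      moreover have "S0 \<in> ?T" using S0 by (auto simp: G_def)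
      ultimately have "?T' j \<subset> ?T" using T'(2) by blast
      then have "card (?T' j) < card ?T" using fin by (intro psubset_card_mono) auto
      then show "Suc t \<le> card ?T" using T'(1)[OF j(1)] by linarith
    qed
    ultimately show ?thesis by blast
  qed
  ultimately show ?case by blast
qed

theorem theorem3:
  fixes \<alpha> \<beta> :: real and c :: nat
  assumes "\<alpha> > 2" and "\<beta> \<ge> 1"
  shows "\<exists>P :: real set. finite P \<and>
    (\<forall>T. minimum_spanning_tree P T \<longrightarrow>
      (\<forall>L. orientation_of T L \<longrightarrow>
        \<not> (\<exists>\<S>. partition_on L \<S> \<and> card \<S> \<le> c \<and>
              (\<forall>S\<in>\<S>. \<forall>l'\<in>S.
                 (\<Sum>l\<in>{l \<in> S. link_length l \<le> link_length l'}. interference \<alpha> l l')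
                   \<le> gamma_const \<alpha> \<beta>))))"
proof -
  let ?g = "gamma_const \<alpha> \<beta>"
  \<comment> \<open>The points are fixed before the orientation and the partition, with one colour
    more than allowed.\<close>
  obtain P :: "real set" and G where P: "finite P" "G \<subseteq> gaps P" "needs_colours \<alpha> ?g (Suc c) G"
    using ex_configuration[of \<alpha> ?g "Suc c"] assms zero_less_one by force
  have False if T: "minimum_spanning_tree P T" and L: "orientation_of T L"
    and \<S>: "partition_on L \<S>" "card \<S> \<le> c" "\<forall>S\<in>\<S>. feasible \<alpha> ?g S" for T L \<S>
  proof -
    have im: "(\<lambda>(s, r). {s, r}) ` L = neighbour_edges P" and "inj_on (\<lambda>(s, r). {s, r}) L"
      using T L P(1) by (auto simp: minimum_spanning_tree_line orientation_of_def bij_betw_def)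
    then have "finite L"
      using P(1) finite_gaps by (metis finite_imageD finite_imageI neighbour_edges_gaps)
    \<comment> \<open>An infinite set has \<open>card\<close> 0, so the bound
      \<open>card \<S> \<le> c\<close> says something only once \<open>\<S>\<close> is known to be
      finite.\<close>
    then have fin: "finite \<S>" "\<forall>S\<in>\<S>. finite S"
      using finite_elements[OF _ \<S>(1)] partition_onD1[OF \<S>(1)]
      by (blast, metis Union_upper finite_subset)
    \<comment> \<open>Every gap is an edge of the tree, so \<open>L\<close> contains it in one
      direction and some class contains that link.\<close>
    have "\<exists>S\<in>\<S>. occurs (u, v) S" if "(u, v) \<in> G" for u v
    proof -
      have "{u, v} \<in> (\<lambda>(s, r). {s, r}) ` L"
        unfolding im using that P(2) by (auto simp: neighbour_edges_gaps)
      then have "occurs (u, v) L" by (auto simp: occurs_def doubleton_eq_iff)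
      then show ?thesis using partition_onD1[OF \<S>(1)] by (auto simp: occurs_def)
    qed
    then have "Suc c \<le> card {S \<in> \<S>. \<exists>x\<in>G. occurs x S}"
      using P(3) fin \<S>(3) by (auto simp: needs_colours_def)
    also have "\<dots> \<le> card \<S>" using fin by (intro card_mono) auto
    finally show False using \<S>(2) by simp
  qed
  then show ?thesis using P(1) unfolding feasible_def by blast
qed

end
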